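(* For $v=(v_1,v_2)\in\mathbb{C}^2$, $$C_N((0,0);v)=\begin{cases}|v_2| & \text{if } |v_2|\ge 2|v_1|,\\ \dfrac{4|v_1|^2+|v_2|^2}{4|v_1|} & \text{if } |v_2|<2|v_1|,\end{cases}$$ and for $(a,b)\in N$ with $(a,b)\neq(0,0)$ and $z\in\mathbb{C}$, $$C_N((a,b);z(3a,2b))=\frac{2|b|}{1-|b|^2}\,|z|.$$
   Context: $\mathbb{D}$ is the open unit disk in $\mathbb{C}$. The Neil parabola is $N=\{(z,w)\in\mathbb{D}^2: z^2=w^3\}$. A function $f:N\to\mathbb{C}$ is holomorphic if for each $x\in N$ there is a holomorphic function $F$ on a neighborhood $U$ of $x$ in $\mathbb{D}^2$ with $F=f$ on $U\cap N$; $\mathcal{O}(N,\mathbb{D})$ is the set of holomorphic functions on $N$ with values in $\mathbb{D}$. The tangent space $T_xN\subset\mathbb{C}^2$ at $x\in N$ is the set of $v\in\mathbb{C}^2$ such that $dG_x v=0$ for every holomorphic $G$ on a neighborhood $U$ of $x$ in $\mathbb{D}^2$ that vanishes identically on $U\cap N$. For $x=(a,b)\ne(0,0)$ in $N$ it is the complex span of $(3a,2b)$; at $x=(0,0)$ it is all of $\mathbb{C}^2$. For $f$ holomorphic on $N$ and $v\in T_xN$, $df_x(v):=dF_x v$ for any local holomorphic extension $F$ of $f$ near $x$ (this is independent of the choice of $F$). The Poincaré metric on $\mathbb{D}$ is $\rho(z;v)=\frac{|v|}{1-|z|^2}$ for $z\in\mathbb{D}$, $v\in\mathbb{C}$. The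 Carathéodory pseudometric of $N$ is $C_N(x;v)=\sup\{\rho(f(x);df_x(v)): f\in\mathcal{O}(N,\mathbb{D})\}$ for $x\in N$, $v\in T_xN$. *)

theory Defs
  imports "HOL-Analysis.Analysis"
begin

text \<open>Points and vectors of \<open>\<complex>\<^sup>2\<close> are pairs of type \<^typ>\<open>complex \<times> complex\<close>.  The scalar
  multiplication the library provides on this product is real, so complex linearity of a
  derivative has to be spelled out: \<open>A\<close> and \<open>B\<close> below are the two complex partial derivatives.\<close>

definition holomorphic2_on :: "(complex \<times> complex \<Rightarrow> complex) \<Rightarrow> (complex \<times> complex) set \<Rightarrow> bool"
  where "holomorphic2_on F U \<longleftrightarrow>
    open U \<and> (\<forall>p\<in>U. \<exists>A B. (F has_derivative (\<lambda>(u, w). A * u + B * w)) (at p))"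

abbreviation unit_disk :: "complex set"
  where "unit_disk \<equiv> ball 0 1"

definition neil_parabola :: "(complex \<times> complex) set"
  where "neil_parabola = {(z, w). z \<in> unit_disk \<and> w \<in> unit_disk \<and> z ^ 2 = w ^ 3}"

definition nbhd_in_bidisk :: "complex \<times> complex \<Rightarrow> (complex \<times> complex) set \<Rightarrow> bool"
  where "nbhd_in_bidisk x U \<longleftrightarrow> open U \<and> x \<in> U \<and> U \<subseteq> unit_disk \<times> unit_disk"

text \<open>Functions on the Neil parabola are represented by total functions on \<open>\<complex>\<^sup>2\<close>; their values
  off the parabola play no role in the following definitions.\<close>

definition local_extension ::
  "(complex \<times> complex \<Rightarrow> complex) \<Rightarrow> complex \<times> complex \<Rightarrow>
   (complex \<times> complex) set \<Rightarrow> (complex \<times> complex \<Rightarrow> complex) \<Rightarrow> bool"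
  where "local_extension f x U F \<longleftrightarrow>
    nbhd_in_bidisk x U \<and> holomorphic2_on F U \<and> (\<forall>y \<in> U \<inter> neil_parabola. F y = f y)"

definition holomorphic_on_neil :: "(complex \<times> complex \<Rightarrow> complex) \<Rightarrow> bool"
  where "holomorphic_on_neil f \<longleftrightarrow> (\<forall>x \<in> neil_parabola. \<exists>U F. local_extension f x U F)"

definition neil_to_disk :: "(complex \<times> complex \<Rightarrow> complex) set"
  where "neil_to_disk = {f. holomorphic_on_neil f \<and> f ` neil_parabola \<subseteq> unit_disk}"

definition neil_tangent_space :: "complex \<times> complex \<Rightarrow> (complex \<times> complex) set"
  where "neil_tangent_space x = {v. \<forall>U G.
    nbhd_in_bidisk x U \<and> holomorphic2_on G U \<and> (\<forall>y \<in> U \<inter> neil_parabola. G y = 0)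
      \<longrightarrow> frechet_derivative G (at x) v = 0}"

text \<open>The description below is meaningful for \<open>v\<close> in the tangent space at \<open>x\<close>: there the value
  does not depend on the chosen local extension.\<close>

definition neil_differential ::
  "(complex \<times> complex \<Rightarrow> complex) \<Rightarrow> complex \<times> complex \<Rightarrow> complex \<times> complex \<Rightarrow> complex"
  where "neil_differential f x v =
    (THE d. \<exists>U F. local_extension f x U F \<and> d = frechet_derivative F (at x) v)"

definition poincare_metric :: "complex \<Rightarrow> complex \<Rightarrow> real"
  where "poincare_metric z v = cmod v / (1 - (cmod z)\<^sup>2)"

text \<open>The supremum is taken in the extended reals, so that no boundedness is presupposed.\<close>

definition caratheodory_neil :: "complex \<times> complex \<Rightarrow> complex \<times> complex \<Rightarrow> ereal"
  where "caratheodory_neil x v =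
    (SUP f \<in> neil_to_disk. ereal (poincare_metric (f x) (neil_differential f x v)))"

end

theory Submission
  imports Defs "HOL-Complex_Analysis.Riemann_Mapping"
begin

text \<open>The map \<open>l \<mapsto> (l ^ 3, l\<^sup>2)\<close> is a holomorphic bijection from the unit disk onto the Neil parabola
  whose velocity vanishes only at \<open>l = 0\<close>.  A holomorphic function \<open>f\<close> on the parabola with values
  in the disk pulls back to a holomorphic self-map \<open>h\<close> of the disk with \<open>deriv h 0 = 0\<close>, and the
  metric becomes an extremal problem for such \<open>h\<close>.  Composing with the disk automorphism that sends
  \<open>h 0\<close> to \<open>0\<close> changes no Poincare length and turns \<open>h\<close> into \<open>z\<^sup>2 * g z\<close>, where \<open>g\<close> is
  holomorphic and bounded by \<open>1\<close> (lemma \<open>critical_at_zero_factor\<close>).  Everything then follows from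
  the inequality \<open>cmod (deriv g z) * (1 - (cmod z)\<^sup>2) \<le> 1 - (cmod (g z))\<^sup>2\<close> of Schwarz and Pick.

  Away from the cusp the differential of \<open>f\<close> along the parabola is a multiple of the derivative of
  the pullback, and Schwarz--Pick for \<open>g\<close> shows that \<open>z \<mapsto> z\<^sup>2\<close>, the pullback of the second
  coordinate, has the largest possible distortion (lemma \<open>critical_at_zero_schwarz_pick\<close>).

  At the cusp the tangent space is two-dimensional and the derivative of the pullback carries no
  information; the partial derivatives of an extension of \<open>f\<close> are the coefficients of \<open>l ^ 3\<close> and
  \<open>l\<^sup>2\<close> in the expansion of \<open>h\<close> (lemma \<open>derivative_at_cusp_from_parabola\<close>).  Up to normalisation
  these are \<open>deriv g 0\<close> and \<open>g 0\<close>, so with \<open>t = cmod (g 0)\<close> the quantity to maximise is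
  \<open>(1 - t\<^sup>2) * cmod v\<^sub>1 + t * cmod v\<^sub>2\<close> for \<open>t\<close> in the unit interval.  The maximum of this quadratic is the
  stated case distinction.  It is attained by the second coordinate when \<open>t = 1\<close> is optimal, and
  otherwise by letting \<open>g\<close> be a disk automorphism with suitable phase
  (lemma \<open>moebius_extremal\<close>).\<close>

section \<open>Moebius maps and the Schwarz--Pick inequality\<close>

lemma moebius_denominator_nonzero:
  assumes "cmod c < 1" "cmod w < 1"
  shows "1 - cnj c * w \<noteq> 0"
proof
  assume "1 - cnj c * w = 0"
  then have "cmod (cnj c * w) = 1" by (metis norm_one right_minus_eq)
  moreover have "cmod (cnj c * w) < 1"
    using norm_mult_less[of "cnj c" 1 w 1] assms by simp
  ultimately show False by simp
qed

lemma moebius_has_field_derivative: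
  assumes "cmod c < 1" "cmod w < 1"
  shows "(Moebius_function 0 c has_field_derivative
           of_real (1 - (cmod c)\<^sup>2) / (1 - cnj c * w)\<^sup>2) (at w)"
proof -
  have nz: "1 - cnj c * w \<noteq> 0" using assms by (rule moebius_denominator_nonzero)
  have cc: "complex_of_real (1 - (cmod c)\<^sup>2) = 1 - c * cnj c"
    using complex_norm_square[of c] by simp
  have "((\<lambda>z. (z - c) / (1 - cnj c * z)) has_field_derivative
           of_real (1 - (cmod c)\<^sup>2) / (1 - cnj c * w)\<^sup>2) (at w)"
    unfolding cc using nz
    by (auto intro!: derivative_eq_intros simp: field_simps power2_eq_square)
  then show ?thesis
    by (simp add: Moebius_function_simple[abs_def])
qed

lemma moebius_norm_identity:
  assumes "cmod c < 1" "cmod w < 1"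
  shows "1 - (cmod (Moebius_function 0 c w))\<^sup>2
           = (1 - (cmod c)\<^sup>2) * (1 - (cmod w)\<^sup>2) / (cmod (1 - cnj c * w))\<^sup>2"
proof -
  have nz: "1 - cnj c * w \<noteq> 0" using assms by (rule moebius_denominator_nonzero)
  have "(cmod (1 - cnj c * w))\<^sup>2 - (cmod (w - c))\<^sup>2 = (1 - (cmod c)\<^sup>2) * (1 - (cmod w)\<^sup>2)"
    unfolding cmod_power2 by (simp add: algebra_simps power2_eq_square)
  with nz show ?thesis
    by (simp add: Moebius_function_simple norm_divide power_divide field_simps)
qed

text \<open>Disk automorphisms are isometries of the Poincare metric.  This is what allows a self-map of
  the disk to be normalised so that it vanishes at the origin.\<close>

lemma poincare_metric_moebius:
  assumes c: "cmod c < 1" and w: "cmod w < 1"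
  shows "poincare_metric (Moebius_function 0 c w)
           (of_real (1 - (cmod c)\<^sup>2) / (1 - cnj c * w)\<^sup>2 * v) = poincare_metric w v"
proof -
  have nz: "cmod (1 - cnj c * w) \<noteq> 0" using moebius_denominator_nonzero[OF c w] by simp
  have p: "1 - (cmod c)\<^sup>2 > 0" "1 - (cmod w)\<^sup>2 > 0"
    using c w by (auto simp: abs_square_less_1)
  have "cmod (complex_of_real (1 - (cmod c)\<^sup>2)) = 1 - (cmod c)\<^sup>2"
    using p by (simp only: norm_of_real)
  then show ?thesis
    using nz p unfolding poincare_metric_def moebius_norm_identity[OF c w] norm_mult norm_divide norm_power
    by (simp add: divide_simps)
qed

text \<open>The Schwarz lemma at the origin, transported to the point \<open>z\<close> by composing with the disk
  automorphisms that move \<open>0\<close> to \<open>z\<close> and \<open>f z\<close> to \<open>0\<close>.\<close>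

lemma schwarz_pick_strict:
  assumes f: "f holomorphic_on ball 0 1" and b: "\<And>z. cmod z < 1 \<Longrightarrow> cmod (f z) < 1"
    and z: "cmod z < 1"
  shows "cmod (deriv f z) * (1 - (cmod z)\<^sup>2) \<le> 1 - (cmod (f z))\<^sup>2"
proof -
  let ?M = "Moebius_function 0"
  define k where "k = ?M (f z) \<circ> (f \<circ> ?M (-z))"
  have mz: "?M (-z) ` ball 0 1 \<subseteq> ball 0 1" using Moebius_function_norm_lt_1 z by auto
  have m0: "?M (-z) 0 = z" by (simp add: Moebius_function_of_zero)
  have fm: "(f \<circ> ?M (-z)) holomorphic_on ball 0 1"
    using Moebius_function_holomorphic z f mz by (metis holomorphic_on_compose_gen norm_minus_cancel)
  have "(f \<circ> ?M (-z)) ` ball 0 1 \<subseteq> ball 0 1" using mz b by fastforce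
  then have hol: "k holomorphic_on ball 0 1"
    unfolding k_def using fm Moebius_function_holomorphic[OF b[OF z]] holomorphic_on_compose_gen by blast
  have k0: "k 0 = 0" by (simp add: k_def m0 Moebius_function_eq_zero)
  have kb: "cmod (k x) < 1" if "cmod x < 1" for x
    unfolding k_def comp_def by (intro Moebius_function_norm_lt_1 b) (use z that in auto)
  have fz: "(f has_field_derivative deriv f z) (at z)"
    using f z by (simp add: holomorphic_derivI)
  have pos: "1 - (cmod z)\<^sup>2 > 0" "1 - (cmod (f z))\<^sup>2 > 0"
    using z b[OF z] by (auto simp: abs_square_less_1)
  have cc: "1 - cnj (f z) * f z = of_real (1 - (cmod (f z))\<^sup>2)"
    using complex_norm_square[of "f z"] by (simp add: mult.commute)
  have d1: "(?M (-z) has_field_derivative of_real (1 - (cmod z)\<^sup>2)) (at 0)"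
    using moebius_has_field_derivative[of "-z" 0] z by simp
  have "(k has_field_derivative of_real (1 - (cmod (f z))\<^sup>2) / (1 - cnj (f z) * f z)\<^sup>2 *
          (deriv f z * of_real (1 - (cmod z)\<^sup>2))) (at 0)"
    unfolding k_def
    by (intro DERIV_chain, simp only: comp_apply m0)
      (use moebius_has_field_derivative[OF b[OF z] b[OF z]] fz d1 m0 in auto)
  then have "deriv k 0 = of_real (1 - (cmod (f z))\<^sup>2) / (1 - cnj (f z) * f z)\<^sup>2 *
          (deriv f z * of_real (1 - (cmod z)\<^sup>2))"
    by (rule DERIV_imp_deriv)
  moreover have "cmod (of_real R / (of_real R)\<^sup>2 * (d * of_real S)) = cmod d * S / R"
    if "R > 0" "S > 0" for R S :: real and d :: complex
    using that by (simp add: norm_mult norm_divide norm_power power2_eq_square)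
  ultimately have "cmod (deriv k 0) = cmod (deriv f z) * (1 - (cmod z)\<^sup>2) / (1 - (cmod (f z))\<^sup>2)"
    unfolding cc using pos by presburger
  with Schwarz_Lemma(2)[OF hol k0 kb, of 0] pos show ?thesis
    by (simp add: divide_simps)
qed

text \<open>The quotient \<open>g\<close> in \<open>k z = z\<^sup>2 * g z\<close> is only known to be bounded by \<open>1\<close>, so unimodular
  constants have to be admitted; by the maximum principle nothing else is new.\<close>

lemma schwarz_pick:
  assumes f: "f holomorphic_on ball 0 1" and b: "\<And>z. cmod z < 1 \<Longrightarrow> cmod (f z) \<le> 1"
    and z: "cmod z < 1"
  shows "cmod (deriv f z) * (1 - (cmod z)\<^sup>2) \<le> 1 - (cmod (f z))\<^sup>2"
proof (cases "\<exists>\<xi>. cmod \<xi> < 1 \<and> cmod (f \<xi>) = 1")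
  case True
  then obtain \<xi> where \<xi>: "cmod \<xi> < 1" "cmod (f \<xi>) = 1" by blast
  have "f constant_on ball 0 1"
    by (rule maximum_modulus_principle[OF f, of "ball 0 1" \<xi>]) (use \<xi> b in auto)
  then obtain c where c: "\<And>x. x \<in> ball 0 1 \<Longrightarrow> f x = c" by (auto simp: constant_on_def)
  have "(f has_field_derivative 0) (at z)"
    by (rule has_field_derivative_transform_within_open[of "\<lambda>_. c" _ _ "ball 0 1"]) (use c z in auto)
  then have "deriv f z = 0" by (rule DERIV_imp_deriv)
  then show ?thesis using b[OF z] by (simp add: abs_square_le_1)
next
  case False
  then show ?thesis using schwarz_pick_strict[OF f _ z] b by force
qed

section \<open>Self-maps of the disk with a critical point at the origin\<close>

text \<open>The maximum principle on \<open>ball 0 r\<close> bounds \<open>g\<close> by \<open>1 / r\<^sup>2\<close>; then \<open>r\<close> tends to \<open>1\<close>.\<close>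

lemma schwarz_order_two:
  assumes k: "k holomorphic_on ball 0 1" and b: "\<And>z. cmod z < 1 \<Longrightarrow> cmod (k z) < 1"
    and k0: "k 0 = 0" and dk0: "deriv k 0 = 0"
  obtains g where "g holomorphic_on ball 0 1" "\<And>z. cmod z < 1 \<Longrightarrow> k z = z\<^sup>2 * g z"
    "\<And>z. cmod z < 1 \<Longrightarrow> cmod (g z) \<le> 1"
proof -
  obtain j where j: "j holomorphic_on ball 0 1" "\<And>z. cmod z < 1 \<Longrightarrow> k z = z * j z" "deriv k 0 = j 0"
    using Schwarz3[OF k k0] by metis
  then have "j 0 = 0" using dk0 by simp
  then obtain g where g: "g holomorphic_on ball 0 1" "\<And>z. cmod z < 1 \<Longrightarrow> j z = z * g z"
    using Schwarz3[OF j(1)] by metis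
  have kg: "k z = z\<^sup>2 * g z" if "cmod z < 1" for z
    using j(2) g(2) that by (simp add: power2_eq_square)
  have "cmod (g z) \<le> 1" if z: "cmod z < 1" for z
  proof -
    have bound: "cmod (g z) * r\<^sup>2 \<le> 1" if r: "cmod z < r" "r < 1" for r
    proof -
      have r0: "0 < r" using r(1) norm_ge_zero[of z] by linarith
      have "cmod (g z) \<le> 1 / r\<^sup>2"
      proof (rule maximum_modulus_frontier[of g "ball 0 r"])
        show "g holomorphic_on interior (ball 0 r)"
          using r g(1) by (auto intro: holomorphic_on_subset)
        show "continuous_on (closure (ball 0 r)) g"
          using r r0 by (auto intro!: holomorphic_on_imp_continuous_on holomorphic_on_subset[OF g(1)])
        fix x :: complex assume "x \<in> frontier (ball 0 r)"
        then have x: "cmod x = r" using r0 by simp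
        then have "cmod (k x) < 1" "cmod (k x) = r\<^sup>2 * cmod (g x)"
          using b[of x] kg[of x] r by (auto simp: norm_mult norm_power)
        then show "cmod (g x) \<le> 1 / r\<^sup>2" using r0 by (simp add: field_simps)
      qed (use r in auto)
      then show ?thesis using r0 by (simp add: field_simps)
    qed
    show ?thesis
    proof (rule tendsto_upperbound)
      show "((\<lambda>r. cmod (g z) * r\<^sup>2) \<longlongrightarrow> cmod (g z)) (at_left (1::real))"
        by (auto intro!: tendsto_eq_intros)
      show "\<forall>\<^sub>F r in at_left 1. cmod (g z) * r\<^sup>2 \<le> 1"
        using eventually_at_left_real[OF z] by eventually_elim (use bound in auto)
    qed simp
  qed
  with g kg that show thesis by blast
qed

text \<open>Every function on the parabola pulls back to such an \<open>h\<close>.  The Moebius map sends \<open>h 0\<close> to \<open>0\<close>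
  and, by the chain rule, keeps the critical point at the origin, so the composition has a double
  zero there.\<close>

lemma critical_at_zero_factor:
  assumes h: "h holomorphic_on ball 0 1" and b: "\<And>z. cmod z < 1 \<Longrightarrow> cmod (h z) < 1"
    and dh0: "deriv h 0 = 0"
  obtains g where "g holomorphic_on ball 0 1" "\<And>z. cmod z < 1 \<Longrightarrow> cmod (g z) \<le> 1"
    "\<And>z. cmod z < 1 \<Longrightarrow> Moebius_function 0 (h 0) (h z) = z\<^sup>2 * g z"
proof -
  let ?k = "Moebius_function 0 (h 0) \<circ> h"
  have h0: "cmod (h 0) < 1" using b by simp
  have "?k holomorphic_on ball 0 1"
    by (rule holomorphic_on_compose_gen[OF h Moebius_function_holomorphic[OF h0]]) (use b in auto)
  moreover have "(?k has_field_derivative of_real (1 - (cmod (h 0))\<^sup>2) / (1 - cnj (h 0) * h 0)\<^sup>2 * 0) (at 0)"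
    using holomorphic_derivI[OF h, of 0] dh0
    by (intro DERIV_chain moebius_has_field_derivative h0) auto
  then have "deriv ?k 0 = 0" using DERIV_imp_deriv by fastforce
  moreover have "cmod (?k z) < 1" if "cmod z < 1" for z
    using Moebius_function_norm_lt_1[OF h0 b[OF that]] by simp
  ultimately obtain g where "g holomorphic_on ball 0 1" "\<And>z. cmod z < 1 \<Longrightarrow> ?k z = z\<^sup>2 * g z"
    "\<And>z. cmod z < 1 \<Longrightarrow> cmod (g z) \<le> 1"
    using schwarz_order_two[of ?k] by (metis Moebius_function_eq_zero comp_apply)
  then show thesis using that[of g] by simp
qed

text \<open>The difference of the two sides is \<open>r * (1 - t)\<close> times an expression that is affine in \<open>t\<close>.
  Its values at \<open>t = 0\<close> and \<open>t = 1\<close> are \<open>2 - r - r ^ 3\<close> and \<open>2 * (1 - r) * (1 - r ^ 3)\<close>, which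
  are both nonnegative.\<close>

lemma schwarz_pick_numeric:
  fixes r t :: real
  assumes r: "0 \<le> r" "r < 1" and t: "0 \<le> t" "t \<le> 1"
  shows "(2 * r * t + r\<^sup>2 * ((1 - t\<^sup>2) / (1 - r\<^sup>2))) * (1 - r ^ 4) \<le> 2 * r * (1 - (r\<^sup>2 * t)\<^sup>2)"
proof -
  have r2: "1 - r\<^sup>2 > 0" using r by (simp add: abs_square_less_1)
  have "0 \<le> (1 - t) * (2 - r - r ^ 3) + t * (2 * (1 - r) * (1 - r ^ 3))"
    using r t power_le_one[of r 3] by (intro add_nonneg_nonneg mult_nonneg_nonneg) auto
  also have "\<dots> = 2 + 2 * r ^ 4 * t - (r + r ^ 3) * (1 + t)"
    by (simp add: algebra_simps eval_nat_numeral)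
  finally have "0 \<le> r * (1 - t) * (2 + 2 * r ^ 4 * t - (r + r ^ 3) * (1 + t))"
    using r t by (intro mult_nonneg_nonneg) auto
  also have "\<dots> = 2 * r * (1 - (r\<^sup>2 * t)\<^sup>2) - (2 * r * t * (1 - r ^ 4) + r\<^sup>2 * (1 - t\<^sup>2) * (1 + r\<^sup>2))"
    by (simp add: algebra_simps eval_nat_numeral)
  also have "2 * r * t * (1 - r ^ 4) + r\<^sup>2 * (1 - t\<^sup>2) * (1 + r\<^sup>2)
      = (2 * r * t + r\<^sup>2 * ((1 - t\<^sup>2) / (1 - r\<^sup>2))) * (1 - r ^ 4)"
  proof -
    have "1 - r ^ 4 = (1 - r\<^sup>2) * (1 + r\<^sup>2)"
      by (simp add: algebra_simps eval_nat_numeral)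
    then have "(1 - t\<^sup>2) / (1 - r\<^sup>2) * (1 - r ^ 4) = (1 - t\<^sup>2) * (1 + r\<^sup>2)"
      using r2 by simp
    then show ?thesis by (simp only: distrib_right mult.assoc)
  qed
  finally show ?thesis by simp
qed

text \<open>The bound is the distortion of \<open>\<lambda>z. z\<^sup>2\<close>.  After normalising \<open>h 0\<close> to \<open>0\<close>, the function is
  \<open>\<lambda>z. z\<^sup>2 * g z\<close> with derivative \<open>2 * l * g l + l\<^sup>2 * deriv g l\<close> at \<open>l\<close>, and the inequality of Schwarz
  and Pick controls \<open>deriv g l\<close> in terms of \<open>g l\<close>; the rest is an inequality in the two real
  numbers \<open>cmod l\<close> and \<open>cmod (g l)\<close>.\<close>

lemma critical_at_zero_schwarz_pick:
  assumes h: "h holomorphic_on ball 0 1" and b: "\<And>z. cmod z < 1 \<Longrightarrow> cmod (h z) < 1"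
    and dh0: "deriv h 0 = 0" and l: "cmod l < 1"
  shows "poincare_metric (h l) (deriv h l) \<le> 2 * cmod l / (1 - cmod l ^ 4)"
proof -
  obtain g where g: "g holomorphic_on ball 0 1" "\<And>z. cmod z < 1 \<Longrightarrow> cmod (g z) \<le> 1"
    and hg: "\<And>z. cmod z < 1 \<Longrightarrow> Moebius_function 0 (h 0) (h z) = z\<^sup>2 * g z"
    using critical_at_zero_factor[OF h b dh0] by metis
  have h0: "cmod (h 0) < 1" using b by simp
  let ?d = "of_real (1 - (cmod (h 0))\<^sup>2) / (1 - cnj (h 0) * h l)\<^sup>2 * deriv h l"
  have dg: "(g has_field_derivative deriv g l) (at l)" using g(1) l by (simp add: holomorphic_derivI)
  have "((\<lambda>z. z\<^sup>2 * g z) has_field_derivative 2 * l * g l + l\<^sup>2 * deriv g l) (at l)"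
    using dg by (auto intro!: derivative_eq_intros)
  then have "(Moebius_function 0 (h 0) \<circ> h has_field_derivative 2 * l * g l + l\<^sup>2 * deriv g l) (at l)"
    by (rule has_field_derivative_transform_within_open[of _ _ _ "ball 0 1"]) (use l hg in auto)
  moreover have "(Moebius_function 0 (h 0) \<circ> h has_field_derivative ?d) (at l)"
    using holomorphic_derivI[OF h, of l] l
    by (intro DERIV_chain moebius_has_field_derivative h0 b) auto
  ultimately have d: "?d = 2 * l * g l + l\<^sup>2 * deriv g l" by (rule DERIV_unique[rotated])
  define r t where "r = cmod l" and "t = cmod (g l)"
  have r: "0 \<le> r" "r < 1" and t: "0 \<le> t" "t \<le> 1" using l g(2) by (auto simp: r_def t_def)
  have r2: "1 - r\<^sup>2 > 0" "1 - r ^ 4 > 0" using r power_less_one_iff[of r] by auto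
  have "r\<^sup>2 * t \<le> r\<^sup>2" using t by (simp add: mult_left_le)
  then have "r\<^sup>2 * t < 1" using r2 by linarith
  then have k1: "1 - (r\<^sup>2 * t)\<^sup>2 > 0" using r t by (simp add: abs_square_less_1)
  have "cmod (deriv g l) * (1 - r\<^sup>2) \<le> 1 - t\<^sup>2"
    using schwarz_pick[OF g l] by (simp add: r_def t_def)
  then have dgl: "cmod (deriv g l) \<le> (1 - t\<^sup>2) / (1 - r\<^sup>2)" using r2 by (simp add: field_simps)
  have "cmod ?d \<le> 2 * r * t + r\<^sup>2 * cmod (deriv g l)"
    unfolding d using norm_triangle_ineq[of "2 * l * g l" "l\<^sup>2 * deriv g l"]
    by (simp add: norm_mult norm_power r_def t_def)
  also have "\<dots> \<le> 2 * r * t + r\<^sup>2 * ((1 - t\<^sup>2) / (1 - r\<^sup>2))"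
    using dgl by (intro add_left_mono mult_left_mono) auto
  finally have "cmod ?d * (1 - r ^ 4) \<le> 2 * r * (1 - (r\<^sup>2 * t)\<^sup>2)"
    using schwarz_pick_numeric[OF r t] r2 by (meson less_imp_le mult_right_mono order_trans)
  then have "cmod ?d / (1 - (r\<^sup>2 * t)\<^sup>2) \<le> 2 * r / (1 - r ^ 4)"
    using r2 k1 by (simp add: divide_simps mult.commute)
  moreover have "poincare_metric (h l) (deriv h l) = poincare_metric (Moebius_function 0 (h 0) (h l)) ?d"
    by (rule poincare_metric_moebius[symmetric]) (use h0 b l in auto)
  moreover have "\<dots> = cmod ?d / (1 - (r\<^sup>2 * t)\<^sup>2)"
    using l by (simp only: poincare_metric_def hg norm_mult norm_power r_def t_def)
  ultimately show ?thesis by (simp add: r_def)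
qed

section \<open>The parametrisation of the Neil parabola\<close>

definition neil_param :: "complex \<Rightarrow> complex \<times> complex"
  where "neil_param l = (l ^ 3, l\<^sup>2)"

lemma neil_param_in_parabola:
  assumes "cmod l < 1"
  shows "neil_param l \<in> neil_parabola"
  using assms by (simp add: neil_param_def neil_parabola_def norm_power power_Suc_less_one
      power_less_one_iff flip: power_mult)

text \<open>Off the origin the parameter is \<open>l = a / b\<close>.\<close>

lemma neil_param_surj:
  assumes "(a, b) \<in> neil_parabola"
  obtains l where "cmod l < 1" "a = l ^ 3" "b = l\<^sup>2"
proof (cases "b = 0")
  case True
  then show thesis using assms that[of 0] by (simp add: neil_parabola_def)
next
  case False
  have ab: "a\<^sup>2 = b ^ 3" "cmod b < 1" using assms by (auto simp: neil_parabola_def)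
  have b: "(a / b)\<^sup>2 = b"
    using ab(1) False by (simp add: power_divide field_simps eval_nat_numeral)
  have a: "(a / b) ^ 3 = a"
    using b False by (simp add: power3_eq_cube power2_eq_square)
  have "(cmod (a / b))\<^sup>2 < 1" using b ab(2) by (metis norm_power)
  then have "cmod (a / b) < 1" by (simp add: abs_square_less_1)
  with a b that[of "a / b"] show thesis by simp
qed

lemma isCont_neil_param: "isCont neil_param l"
  unfolding neil_param_def by (intro continuous_intros)

lemma has_field_derivative_along_curve:
  assumes F: "(F has_derivative (\<lambda>(u, w). A * u + B * w)) (at (p l, q l))"
    and p: "(p has_field_derivative p') (at l)" and q: "(q has_field_derivative q') (at l)"
  shows "((\<lambda>t. F (p t, q t)) has_field_derivative A * p' + B * q') (at l)"
proof -
  have "((\<lambda>t. (p t, q t)) has_derivative (\<lambda>h. (p' * h, q' * h))) (at l)"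
    using p q unfolding has_field_derivative_def by (intro has_derivative_Pair)
  from has_derivative_compose[OF this F]
  have "((\<lambda>t. F (p t, q t)) has_derivative (\<lambda>h. A * (p' * h) + B * (q' * h))) (at l)"
    by simp
  then show ?thesis
    unfolding has_field_derivative_def by (rule has_derivative_eq_rhs) (auto simp: algebra_simps)
qed

lemma has_field_derivative_along_neil_param:
  assumes "(F has_derivative (\<lambda>(u, w). A * u + B * w)) (at (neil_param l))"
  shows "(F \<circ> neil_param has_field_derivative A * (3 * l\<^sup>2) + B * (2 * l)) (at l)"
  unfolding comp_def neil_param_def
  by (rule has_field_derivative_along_curve)
    (use assms in \<open>auto simp: neil_param_def intro!: derivative_eq_intros\<close>)

section \<open>Recovering the derivative at the cusp from values on the parabola\<close>

text \<open>Total differentiability at the cusp gives only \<open>G (l ^ 3, l\<^sup>2) = G (0, 0) + B * l\<^sup>2 + o (l\<^sup>2)\<close>, in which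
  the term \<open>A * l ^ 3\<close> is invisible.  The symmetric difference quotient in the first variable does
  see it, provided its limit is uniform in the second variable.  Uniformity comes from
  holomorphy: the odd function \<open>z \<mapsto> (G (z, w) - G (- z, w)) - (G (z, 0) - G (- z, 0))\<close> vanishes
  at \<open>0\<close> and is uniformly small for small \<open>w\<close>, so the Schwarz lemma bounds it by a small multiple
  of \<open>cmod z\<close>.\<close>

lemma partial_derivative_fst_limit:
  assumes G: "holomorphic2_on G U" and U: "(0, 0) \<in> U"
    and D: "(G has_derivative (\<lambda>(u, w). A * u + B * w)) (at (0, 0))"
    and e: "0 < e"
  obtains d where "0 < d"
    "\<And>z w. \<lbrakk>z \<noteq> 0; cmod z < d; cmod w < d\<rbrakk> \<Longrightarrow> cmod ((G (z, w) - G (- z, w)) / (2 * z) - A) < e"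
proof -
  have "open U" and der: "\<And>p. p \<in> U \<Longrightarrow> \<exists>A B. (G has_derivative (\<lambda>(u, w). A * u + B * w)) (at p)"
    using G by (auto simp: holomorphic2_on_def)
  then obtain X Y where XY: "open X" "open Y" "(0::complex) \<in> X" "(0::complex) \<in> Y" "X \<times> Y \<subseteq> U"
    using U open_prod_elim[of U "(0,0)"] by (metis mem_Sigma_iff)
  then obtain r1 r2 where r12: "r1 > 0" "cball 0 r1 \<subseteq> X" "r2 > 0" "cball 0 r2 \<subseteq> Y"
    by (meson open_contains_cball)
  define r where "r = min r1 r2"
  have r: "r > 0" "cball 0 r \<times> cball 0 r \<subseteq> U"
    using r12 XY(5) by (auto simp: r_def subset_iff)
  have contG: "continuous_on U G"
    using der has_derivative_continuous \<open>open U\<close> by (metis continuous_at_imp_continuous_on)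
  have "uniformly_continuous_on (cball 0 r \<times> cball 0 r) G"
    by (rule compact_uniformly_continuous)
      (use r contG in \<open>auto intro: continuous_on_subset compact_Times\<close>)
  \<comment> \<open>The four values of \<open>G\<close> contribute at most \<open>2 * \<eta>\<close>, hence \<open>\<eta> / r = e / 4\<close> to the quotient
      by \<open>2 * z\<close>.\<close>
  moreover define \<eta> where "\<eta> = r * e / 4"
  have \<eta>: "\<eta> > 0" using r e by (simp add: \<eta>_def)
  ultimately obtain \<delta> where \<delta>: "\<delta> > 0"
    "\<And>p q. \<lbrakk>p \<in> cball 0 r \<times> cball 0 r; q \<in> cball 0 r \<times> cball 0 r; dist q p < \<delta>\<rbrakk> \<Longrightarrow> dist (G q) (G p) < \<eta>"
    unfolding uniformly_continuous_on_def by metis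
  have slice: "(\<lambda>z. G (s * z, w)) field_differentiable at z"
    if "cmod z < r" "cmod w < r" "cmod s = 1" for z w s
  proof -
    have "(s * z, w) \<in> U" using that r by (auto simp: norm_mult)
    from der[OF this] obtain A' B' where
      "(G has_derivative (\<lambda>(u, w). A' * u + B' * w)) (at (s * z, w))" by blast
    from has_field_derivative_along_curve[of G A' B' "\<lambda>z. s * z" z "\<lambda>_. w" s 0] this
    show ?thesis
      unfolding field_differentiable_def by (auto intro!: derivative_eq_intros)
  qed
  have vary_w: "cmod ((G (z, w) - G (- z, w)) / (2 * z) - (G (z, 0) - G (- z, 0)) / (2 * z)) \<le> e / 4"
    if z: "z \<noteq> 0" "cmod z < r" and w: "cmod w < r" "cmod w < \<delta>" for z w
  proof -
    \<comment> \<open>The factors \<open>1\<close> and \<open>- 1\<close> make all four terms instances of \<open>slice\<close>; the rescaling by \<open>r\<close>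
        puts the domain in the unit disk, where the Schwarz lemma applies.\<close>
    define D where "D t = G (1 * (of_real r * t), w) - G (- 1 * (of_real r * t), w)
       - G (1 * (of_real r * t), 0) + G (- 1 * (of_real r * t), 0)" for t
    define f where "f t = D t / (2 * of_real \<eta>)" for t
    have "f holomorphic_on ball 0 1"
    proof -
      have *: "(\<lambda>t. G (s * (of_real r * t), w')) field_differentiable at t"
        if "cmod t < 1" "cmod w' < r" "cmod s = 1" for t w' s
      proof -
        have "cmod (of_real r * t) < r" using that r by (simp add: norm_mult)
        from slice[OF this that(2,3)]
        have "(\<lambda>z. G (s * z, w')) \<circ> (\<lambda>t. of_real r * t) field_differentiable at t"
          by (intro field_differentiable_compose derivative_intros)
        then show ?thesis by (simp add: comp_def)
      qed
      have "D field_differentiable at t" if "cmod t < 1" for t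
        unfolding D_def[abs_def]
        by (intro field_differentiable_add field_differentiable_diff *) (use that w r in auto)
      then have "D holomorphic_on ball 0 1"
        by (simp add: holomorphic_on_def field_differentiable_at_within)
      then show ?thesis unfolding f_def using \<eta> by (intro holomorphic_intros) auto
    qed
    moreover have "f 0 = 0" by (simp add: f_def D_def)
    moreover have "cmod (f t) < 1" if t: "cmod t < 1" for t
    proof -
      have *: "cmod (G (x, w) - G (x, 0)) < \<eta>" if "cmod x < r" for x
        using \<delta>(2)[of "(x, 0)" "(x, w)"] that w r by (auto simp: dist_norm dist_Pair_Pair)
      have rt: "cmod (of_real r * t) < r" using t r by (simp add: norm_mult)
      have "D t = (G (of_real r * t, w) - G (of_real r * t, 0))
          - (G (- (of_real r * t), w) - G (- (of_real r * t), 0))"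
        by (simp add: D_def)
      then have "cmod (D t) < \<eta> + \<eta>"
        using *[OF rt] *[of "- (of_real r * t)"] rt norm_triangle_ineq4
        by (smt (verit) norm_minus_cancel)
      then show ?thesis using \<eta> by (simp add: f_def norm_divide norm_mult)
    qed
    moreover have "cmod (z / of_real r) < 1" using z r by (simp add: norm_divide)
    ultimately have "cmod (f (z / of_real r)) \<le> cmod (z / of_real r)"
      by (rule Schwarz_Lemma(1))
    then have "cmod (D (z / of_real r)) \<le> 2 * \<eta> * (cmod z / r)"
      using \<eta> r by (simp add: f_def norm_divide norm_mult field_simps)
    also have "\<dots> = e / 4 * cmod (2 * z)" using r by (simp add: \<eta>_def norm_mult)
    finally have "cmod (D (z / of_real r) / (2 * z)) \<le> e / 4"
      using z by (simp add: norm_divide norm_mult field_simps)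
    moreover have "D (z / of_real r) / (2 * z)
        = (G (z, w) - G (- z, w)) / (2 * z) - (G (z, 0) - G (- z, 0)) / (2 * z)"
      using r z by (simp add: D_def diff_divide_distrib add_divide_distrib)
    ultimately show ?thesis by simp
  qed
  have "((\<lambda>z. G (z, 0)) has_field_derivative A * 1 + B * 0) (at 0)"
    by (rule has_field_derivative_along_curve) (use D in auto)
  moreover have "((\<lambda>z. G (- z, 0)) has_field_derivative A * (- 1) + B * 0) (at 0)"
    by (rule has_field_derivative_along_curve) (use D in \<open>auto intro!: derivative_eq_intros\<close>)
  ultimately have "((\<lambda>z. (G (z, 0) - G (- z, 0)) / 2) has_field_derivative A) (at 0)"
    by (auto intro!: derivative_eq_intros)
  then have "(\<lambda>z. (G (z, 0) - G (- z, 0)) / (2 * z)) \<midarrow>0\<rightarrow> A"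
    by (simp add: has_field_derivative_iff)
  from LIM_D[OF this, of "e / 2"] e obtain s where s: "s > 0"
    "\<And>z. z \<noteq> 0 \<Longrightarrow> cmod z < s \<Longrightarrow> cmod ((G (z, 0) - G (- z, 0)) / (2 * z) - A) < e / 2"
    by auto
  show thesis
  proof (rule that[of "Min {r, \<delta>, s}"])
    fix z w assume "z \<noteq> 0" "cmod z < Min {r, \<delta>, s}" "cmod w < Min {r, \<delta>, s}"
    then have "cmod ((G (z, w) - G (- z, w)) / (2 * z) - (G (z, 0) - G (- z, 0)) / (2 * z)) \<le> e / 4"
      "cmod ((G (z, 0) - G (- z, 0)) / (2 * z) - A) < e / 2"
      using vary_w s(2) by auto
    then have "cmod ((G (z, w) - G (- z, w)) / (2 * z) - A) \<le> e / 4 + e / 2"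
      by (intro norm_diff_triangle_le[where y = "(G (z, 0) - G (- z, 0)) / (2 * z)"]) auto
    then show "cmod ((G (z, w) - G (- z, w)) / (2 * z) - A) < e" using e by linarith
  qed (use r \<delta> s in auto)
qed

text \<open>The points with parameters \<open>l\<close> and \<open>- l\<close> have the same second coordinate and opposite first
  coordinates, so the symmetric difference quotient at \<open>z = l ^ 3\<close> uses values on the parabola
  only.\<close>

lemma partial_derivative_fst_from_parabola:
  assumes G: "holomorphic2_on G U" and U: "(0, 0) \<in> U"
    and D: "(G has_derivative (\<lambda>(u, w). A * u + B * w)) (at (0, 0))"
  shows "(\<lambda>l. (G (neil_param l) - G (neil_param (- l))) / (2 * l ^ 3)) \<midarrow>0\<rightarrow> A"
proof (rule LIM_I)
  fix e :: real assume "0 < e"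
  then obtain d where d: "0 < d"
    "\<And>z w. \<lbrakk>z \<noteq> 0; cmod z < d; cmod w < d\<rbrakk> \<Longrightarrow> cmod ((G (z, w) - G (- z, w)) / (2 * z) - A) < e"
    using partial_derivative_fst_limit[OF G U D] by metis
  have "cmod ((G (neil_param l) - G (neil_param (- l))) / (2 * l ^ 3) - A) < e"
    if l: "l \<noteq> 0" "cmod l < min 1 d" for l
  proof -
    have "cmod (l ^ n) < d" if "n > 0" for n
      using power_le_one_iff power_decreasing[of 1 n "cmod l"] l that by (auto simp: norm_power)
    then show ?thesis
      using d(2)[of "l ^ 3" "l\<^sup>2"] l by (simp add: neil_param_def)
  qed
  then show "\<exists>s>0. \<forall>x. x \<noteq> 0 \<and> cmod (x - 0) < s \<longrightarrow>
      cmod ((G (neil_param x) - G (neil_param (- x))) / (2 * x ^ 3) - A) < e"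
    using d(1) by (intro exI[of _ "min 1 d"]) auto
qed

text \<open>Here the definition of the total derivative suffices, because the norm of \<open>neil_param l\<close> is
  asymptotic to \<open>(cmod l)\<^sup>2\<close> and the term \<open>A * l ^ 3\<close> is of smaller order.\<close>

lemma partial_derivative_snd_from_parabola:
  assumes D: "(G has_derivative (\<lambda>(u, w). A * u + B * w)) (at (0, 0))"
  shows "(\<lambda>l. (G (neil_param l) - G (0, 0)) / l\<^sup>2) \<midarrow>0\<rightarrow> B"
proof -
  have ne: "\<forall>\<^sub>F l in at (0::complex). l \<noteq> 0" by (rule eventually_neq_at_within)
  define R where "R p = (G p - G (0, 0) - (A * fst p + B * snd p)) /\<^sub>R norm p" for p
  have "R \<midarrow>0\<rightarrow> 0"
  proof (rule tendsto_norm_zero_cancel)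
    have [simp]: "(0, 0) + h = h" for h :: "complex \<times> complex" by (simp add: prod_eq_iff)
    show "(\<lambda>p. norm (R p)) \<midarrow>0\<rightarrow> 0"
      using D unfolding has_derivative_at
      by (simp add: R_def case_prod_unfold zero_prod_def divide_inverse mult.commute)
  qed
  moreover have "neil_param \<midarrow>0\<rightarrow> 0"
    using isCont_neil_param[of 0] by (simp add: isCont_def neil_param_def zero_prod_def)
  moreover have "\<forall>\<^sub>F l in at 0. neil_param l \<noteq> 0"
    by (auto simp: neil_param_def zero_prod_def eventually_at intro!: exI[of _ 1])
  ultimately have "(\<lambda>l. R (neil_param l)) \<midarrow>0\<rightarrow> 0"
    by (rule tendsto_compose_eventually)
  moreover have "(\<lambda>l. norm (neil_param l) / (cmod l)\<^sup>2) \<midarrow>0\<rightarrow> 1"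
  proof (rule Lim_transform_eventually)
    show "(\<lambda>l. sqrt ((cmod l)\<^sup>2 + 1)) \<midarrow>(0::complex)\<rightarrow> 1"
      by (auto intro!: tendsto_eq_intros)
    have "sqrt ((cmod l)\<^sup>2 + 1) = norm (neil_param l) / (cmod l)\<^sup>2" if "l \<noteq> 0" for l :: complex
    proof -
      have "(norm (neil_param l))\<^sup>2 = ((cmod l)\<^sup>2 * sqrt ((cmod l)\<^sup>2 + 1))\<^sup>2"
        by (simp add: neil_param_def norm_Pair norm_power power_mult_distrib algebra_simps
            flip: power_mult power_add)
      then have "norm (neil_param l) = (cmod l)\<^sup>2 * sqrt ((cmod l)\<^sup>2 + 1)"
        by (simp add: power2_eq_iff_nonneg)
      then show ?thesis using that by simp
    qed
    then show "\<forall>\<^sub>F l in at 0. sqrt ((cmod l)\<^sup>2 + 1) = norm (neil_param l) / (cmod l)\<^sup>2"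
      by (auto simp: eventually_at intro!: exI[of _ 1])
  qed
  ultimately have "(\<lambda>l. cmod (R (neil_param l)) * (norm (neil_param l) / (cmod l)\<^sup>2)) \<midarrow>0\<rightarrow> 0 * 1"
    by (intro tendsto_mult tendsto_norm_zero)
  moreover have "\<forall>\<^sub>F l in at 0. cmod (R (neil_param l)) * (norm (neil_param l) / (cmod l)\<^sup>2)
      = cmod ((G (neil_param l) - G (0, 0) - (A * l ^ 3 + B * l\<^sup>2)) / l\<^sup>2)"
    using ne
  proof eventually_elim
    fix l :: complex assume "l \<noteq> 0"
    then have "norm (neil_param l) \<noteq> 0" by (simp add: neil_param_def zero_prod_def)
    then show "cmod (R (neil_param l)) * (norm (neil_param l) / (cmod l)\<^sup>2)
        = cmod ((G (neil_param l) - G (0, 0) - (A * l ^ 3 + B * l\<^sup>2)) / l\<^sup>2)"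
      by (simp add: R_def neil_param_def norm_divide norm_power)
  qed
  ultimately have "(\<lambda>l. cmod ((G (neil_param l) - G (0, 0) - (A * l ^ 3 + B * l\<^sup>2)) / l\<^sup>2)) \<midarrow>0\<rightarrow> 0"
    using Lim_transform_eventually by fastforce
  then have "(\<lambda>l. (G (neil_param l) - G (0, 0) - (A * l ^ 3 + B * l\<^sup>2)) / l\<^sup>2) \<midarrow>0\<rightarrow> 0"
    by (rule tendsto_norm_zero_cancel)
  moreover have "(\<lambda>l. A * l + B) \<midarrow>0\<rightarrow> B" by (auto intro!: tendsto_eq_intros)
  ultimately have "(\<lambda>l. (G (neil_param l) - G (0, 0) - (A * l ^ 3 + B * l\<^sup>2)) / l\<^sup>2 + (A * l + B)) \<midarrow>0\<rightarrow> 0 + B"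
    by (rule tendsto_add)
  moreover have "\<forall>\<^sub>F l in at 0. (G (neil_param l) - G (0, 0) - (A * l ^ 3 + B * l\<^sup>2)) / l\<^sup>2 + (A * l + B)
      = (G (neil_param l) - G (0, 0)) / l\<^sup>2"
    using ne by eventually_elim (simp add: field_simps eval_nat_numeral)
  ultimately show ?thesis using Lim_transform_eventually by fastforce
qed

text \<open>In terms of \<open>h l = G (neil_param l)\<close>: the two partial derivatives at the cusp are the
  coefficients of \<open>l ^ 3\<close> and \<open>l\<^sup>2\<close> in the expansion of \<open>h\<close>.\<close>

lemma derivative_at_cusp_from_parabola:
  assumes G: "holomorphic2_on G U" and U: "(0, 0) \<in> U"
    and D: "(G has_derivative (\<lambda>(u, w). A * u + B * w)) (at (0, 0))"
    and q: "\<forall>\<^sub>F l in at 0. G (neil_param l) = G (0, 0) + l\<^sup>2 * q l"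
    and q': "(q has_field_derivative q') (at 0)"
  shows "A = q'" "B = q 0"
proof -
  have ne: "\<forall>\<^sub>F l in at (0::complex). l \<noteq> 0" by (rule eventually_neq_at_within)
  have "\<forall>\<^sub>F l in at 0. (G (neil_param l) - G (0, 0)) / l\<^sup>2 = q l"
    using q ne by eventually_elim simp
  from Lim_transform_eventually[OF partial_derivative_snd_from_parabola[OF D] this]
  have "q \<midarrow>0\<rightarrow> B" .
  moreover have "q \<midarrow>0\<rightarrow> q 0" using DERIV_isCont[OF q'] by (simp add: isCont_def)
  ultimately show "B = q 0" by (rule LIM_unique)
  have "((\<lambda>l. q (- l)) has_field_derivative - q') (at 0)"
    using DERIV_chain2[of q q' uminus 0 "- 1" UNIV] q' by (simp add: DERIV_minus[OF DERIV_ident])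
  with q' have "((\<lambda>l. (q l - q (- l)) / 2) has_field_derivative (q' - - q') / 2) (at 0)"
    by (intro DERIV_cdivide DERIV_diff)
  then have lim: "(\<lambda>l. (q l - q (- l)) / (2 * l)) \<midarrow>0\<rightarrow> q'"
    by (simp add: has_field_derivative_iff)
  have "filterlim uminus (at (0::complex)) (at 0)"
    by (auto simp: filterlim_at eventually_at intro!: tendsto_eq_intros exI[of _ 1])
  with q have "\<forall>\<^sub>F l in at 0. G (neil_param (- l)) = G (0, 0) + (- l)\<^sup>2 * q (- l)"
    by (rule eventually_compose_filterlim)
  with q ne have "\<forall>\<^sub>F l in at 0. (G (neil_param l) - G (neil_param (- l))) / (2 * l ^ 3) = (q l - q (- l)) / (2 * l)"
    by eventually_elim (simp add: field_simps eval_nat_numeral)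
  from Lim_transform_eventually[OF partial_derivative_fst_from_parabola[OF G U D] this]
  show "A = q'" using lim by (rule LIM_unique)
qed

section \<open>Tangent spaces and the differential\<close>

lemma holomorphic2_on_derivative:
  assumes "holomorphic2_on F U" "p \<in> U"
  obtains A B where "(F has_derivative (\<lambda>(u, w). A * u + B * w)) (at p)"
  using assms unfolding holomorphic2_on_def by blast

lemma eventually_neil_param_in_nbhd:
  assumes U: "nbhd_in_bidisk (neil_param l) U" and l: "cmod l < 1"
  shows "\<forall>\<^sub>F t in nhds l. neil_param t \<in> U \<inter> neil_parabola"
proof -
  have "open (neil_param -` U \<inter> ball 0 1)"
    using U isCont_neil_param
    by (intro open_Int open_vimage continuous_at_imp_continuous_on) (auto simp: nbhd_in_bidisk_def)
  then have "\<forall>\<^sub>F t in nhds l. t \<in> neil_param -` U \<inter> ball 0 1"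
    using U l by (intro eventually_nhds_in_open) (auto simp: nbhd_in_bidisk_def)
  then show ?thesis
    by eventually_elim (simp add: neil_param_in_parabola)
qed

text \<open>The vector \<open>(3 * l\<^sup>2, 2 * l)\<close> is the velocity of the parametrisation at \<open>l\<close>, and \<open>G\<close> composed
  with the parametrisation is locally zero.\<close>

lemma derivative_vanishes_on_velocity:
  assumes U: "nbhd_in_bidisk (neil_param l) U" and l: "cmod l < 1"
    and G0: "\<And>y. y \<in> U \<inter> neil_parabola \<Longrightarrow> G y = 0"
    and D: "(G has_derivative (\<lambda>(u, w). A * u + B * w)) (at (neil_param l))"
  shows "A * (3 * l\<^sup>2) + B * (2 * l) = 0"
proof -
  have "\<forall>\<^sub>F t in nhds l. (G \<circ> neil_param) t = 0"
    using eventually_neil_param_in_nbhd[OF U l] by eventually_elim (simp add: G0)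
  then have "(G \<circ> neil_param has_field_derivative A * (3 * l\<^sup>2) + B * (2 * l)) (at l)
      \<longleftrightarrow> ((\<lambda>_. 0) has_field_derivative A * (3 * l\<^sup>2) + B * (2 * l)) (at l)"
    by (intro DERIV_cong_ev) auto
  then show ?thesis
    using has_field_derivative_along_neil_param[OF D] DERIV_unique[OF _ DERIV_const] by blast
qed

lemma tangent_along_parabola:
  assumes l: "cmod l < 1"
  shows "(s * (3 * l\<^sup>2), s * (2 * l)) \<in> neil_tangent_space (neil_param l)"
  unfolding neil_tangent_space_def
proof (intro CollectI allI impI, elim conjE)
  fix U G
  assume U: "nbhd_in_bidisk (neil_param l) U" and G: "holomorphic2_on G U"
    and G0: "\<forall>y\<in>U \<inter> neil_parabola. G y = 0"
  have "neil_param l \<in> U" using U by (simp add: nbhd_in_bidisk_def)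
  from holomorphic2_on_derivative[OF G this]
  obtain A B where D: "(G has_derivative (\<lambda>(u, w). A * u + B * w)) (at (neil_param l))" .
  have "A * (3 * l\<^sup>2) + B * (2 * l) = 0"
    using derivative_vanishes_on_velocity[OF U l _ D] G0 by blast
  then have "s * (A * (3 * l\<^sup>2) + B * (2 * l)) = 0" by simp
  then show "frechet_derivative G (at (neil_param l)) (s * (3 * l\<^sup>2), s * (2 * l)) = 0"
    unfolding frechet_derivative_at[OF D, symmetric] by (simp add: algebra_simps)
qed

text \<open>A function vanishing on the parabola satisfies the expansion at the cusp with \<open>q = 0\<close>, so both of
  its partial derivatives there are zero and its differential annihilates every vector.\<close>

lemma tangent_space_cusp: "v \<in> neil_tangent_space (0, 0)"
  unfolding neil_tangent_space_def
proof (intro CollectI allI impI, elim conjE)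
  fix U G
  assume U: "nbhd_in_bidisk (0, 0) U" and G: "holomorphic2_on G U"
    and G0: "\<forall>y\<in>U \<inter> neil_parabola. G y = 0"
  have U0: "(0, 0) \<in> U" using U by (simp add: nbhd_in_bidisk_def)
  obtain A B where D: "(G has_derivative (\<lambda>(u, w). A * u + B * w)) (at (0, 0))"
    using holomorphic2_on_derivative[OF G U0] .
  have "G (0, 0) = 0" using G0 U0 by (auto simp: neil_parabola_def)
  moreover have "\<forall>\<^sub>F t in nhds 0. neil_param t \<in> U \<inter> neil_parabola"
    using eventually_neil_param_in_nbhd[of 0 U] U by (simp add: neil_param_def)
  ultimately have "\<forall>\<^sub>F l in nhds 0. G (neil_param l) = G (0, 0) + l\<^sup>2 * 0"
    using G0 by (auto elim!: eventually_mono)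
  then have "\<forall>\<^sub>F l in at 0. G (neil_param l) = G (0, 0) + l\<^sup>2 * 0"
    by (simp add: eventually_at_filter eventually_mono)
  from derivative_at_cusp_from_parabola[OF G U0 D this DERIV_const]
  have "A = 0" "B = 0" by auto
  then show "frechet_derivative G (at (0, 0)) v = 0"
    unfolding frechet_derivative_at[OF D, symmetric] by (simp add: case_prod_unfold)
qed

lemma local_extension_derivative:
  assumes "local_extension f x U F"
  obtains A B where "(F has_derivative (\<lambda>(u, w). A * u + B * w)) (at x)"
  by (rule holomorphic2_on_derivative[of F U x])
    (use assms in \<open>auto simp: local_extension_def nbhd_in_bidisk_def\<close>)

text \<open>The difference of two local extensions of \<open>f\<close> vanishes on the parabola near \<open>x\<close>, so its
  derivative kills every tangent vector.  Hence the description that defines \<open>neil_differential\<close> has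
  exactly one value.\<close>

lemma neil_differential_eq:
  assumes v: "v \<in> neil_tangent_space x" and F: "local_extension f x U F"
    and D: "(F has_derivative F') (at x)"
  shows "neil_differential f x v = F' v"
  unfolding neil_differential_def
proof (rule the_equality)
  show "\<exists>U F. local_extension f x U F \<and> F' v = frechet_derivative F (at x) v"
    using F frechet_derivative_at[OF D] by metis
next
  fix d assume "\<exists>U F. local_extension f x U F \<and> d = frechet_derivative F (at x) v"
  then obtain V H where H: "local_extension f x V H" and d: "d = frechet_derivative H (at x) v"
    by blast
  obtain A B where D2: "(H has_derivative (\<lambda>(u, w). A * u + B * w)) (at x)"
    using H by (rule local_extension_derivative)
  have hol: "holomorphic2_on F U" "holomorphic2_on H V"
    using F H by (auto simp: local_extension_def)
  let ?G = "\<lambda>p. F p - H p"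
  have "holomorphic2_on ?G (U \<inter> V)"
    unfolding holomorphic2_on_def
  proof (intro conjI ballI)
    show "open (U \<inter> V)" using F H by (auto simp: local_extension_def nbhd_in_bidisk_def)
    fix p assume "p \<in> U \<inter> V"
    then have p: "p \<in> U" "p \<in> V" by auto
    obtain A B where DF: "(F has_derivative (\<lambda>(u, w). A * u + B * w)) (at p)"
      using holomorphic2_on_derivative[OF hol(1) p(1)] .
    obtain A' B' where DH: "(H has_derivative (\<lambda>(u, w). A' * u + B' * w)) (at p)"
      using holomorphic2_on_derivative[OF hol(2) p(2)] .
    from has_derivative_diff[OF DF DH]
    have "(?G has_derivative (\<lambda>(u, w). (A - A') * u + (B - B') * w)) (at p)"
      by (rule has_derivative_eq_rhs) (auto simp: algebra_simps)
    then show "\<exists>A B. (?G has_derivative (\<lambda>(u, w). A * u + B * w)) (at p)" by blast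
  qed
  moreover have "nbhd_in_bidisk x (U \<inter> V)"
    using F H by (auto simp: local_extension_def nbhd_in_bidisk_def)
  moreover have "\<forall>y \<in> U \<inter> V \<inter> neil_parabola. ?G y = 0"
    using F H by (auto simp: local_extension_def)
  ultimately have "frechet_derivative ?G (at x) v = 0"
    using v unfolding neil_tangent_space_def by blast
  moreover have "frechet_derivative ?G (at x) v = F' v - frechet_derivative H (at x) v"
    unfolding frechet_derivative_at[OF has_derivative_diff[OF D D2], symmetric]
      frechet_derivative_at[OF D2, symmetric] by simp
  ultimately show "d = F' v" using d by simp
qed

section \<open>Upper bounds for the metric\<close>

lemma pullback_derivative:
  assumes F: "local_extension f (neil_param l) U F" and l: "cmod l < 1"
    and D: "(F has_derivative (\<lambda>(u, w). A * u + B * w)) (at (neil_param l))"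
  shows "(f \<circ> neil_param has_field_derivative A * (3 * l\<^sup>2) + B * (2 * l)) (at l)"
proof -
  have "\<forall>\<^sub>F t in nhds l. neil_param t \<in> U \<inter> neil_parabola"
    using F l by (intro eventually_neil_param_in_nbhd) (auto simp: local_extension_def)
  then have "\<forall>\<^sub>F t in nhds l. (f \<circ> neil_param) t = (F \<circ> neil_param) t"
    using F by (auto simp: local_extension_def elim!: eventually_mono)
  then have "(f \<circ> neil_param has_field_derivative A * (3 * l\<^sup>2) + B * (2 * l)) (at l)
      \<longleftrightarrow> (F \<circ> neil_param has_field_derivative A * (3 * l\<^sup>2) + B * (2 * l)) (at l)"
    by (intro DERIV_cong_ev) auto
  then show ?thesis using has_field_derivative_along_neil_param[OF D] by blast
qed

lemma neil_to_disk_local_extension: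
  assumes "f \<in> neil_to_disk" "x \<in> neil_parabola"
  obtains U F A B where "local_extension f x U F"
    "(F has_derivative (\<lambda>(u, w). A * u + B * w)) (at x)"
proof -
  obtain U F where F: "local_extension f x U F"
    using assms by (auto simp: neil_to_disk_def holomorphic_on_neil_def)
  moreover from F obtain A B where "(F has_derivative (\<lambda>(u, w). A * u + B * w)) (at x)"
    by (rule local_extension_derivative)
  ultimately show thesis by (rule that)
qed

text \<open>The velocity of the parametrisation vanishes at the origin, which forces the critical point of
  the pullback there.\<close>

lemma pullback_disk:
  assumes f: "f \<in> neil_to_disk"
  shows "f \<circ> neil_param holomorphic_on ball 0 1"
    "\<And>l. cmod l < 1 \<Longrightarrow> cmod ((f \<circ> neil_param) l) < 1"
    "deriv (f \<circ> neil_param) 0 = 0"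
proof -
  have d: "\<exists>A B. (f \<circ> neil_param has_field_derivative A * (3 * l\<^sup>2) + B * (2 * l)) (at l)"
    if l: "cmod l < 1" for l
  proof -
    obtain U F A B where F: "local_extension f (neil_param l) U F"
      and D: "(F has_derivative (\<lambda>(u, w). A * u + B * w)) (at (neil_param l))"
      using neil_to_disk_local_extension[OF f neil_param_in_parabola[OF l]] .
    from pullback_derivative[OF F l D] show ?thesis by blast
  qed
  then show "f \<circ> neil_param holomorphic_on ball 0 1"
    unfolding holomorphic_on_def field_differentiable_def
    by (metis has_field_derivative_at_within mem_ball_0)
  show "cmod ((f \<circ> neil_param) l) < 1" if "cmod l < 1" for l
    using f neil_param_in_parabola[OF that] by (auto simp: neil_to_disk_def)
  show "deriv (f \<circ> neil_param) 0 = 0"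
    using d[of 0] by (auto intro: DERIV_imp_deriv)
qed

text \<open>The tangent vector is \<open>s\<close> times the velocity of the parametrisation, so by the chain rule the
  differential of \<open>f\<close> on it is \<open>s\<close> times the derivative of the pullback at \<open>l\<close>.\<close>

lemma neil_metric_bound_along_curve:
  assumes f: "f \<in> neil_to_disk" and l: "cmod l < 1"
  shows "poincare_metric (f (neil_param l)) (neil_differential f (neil_param l) (s * (3 * l\<^sup>2), s * (2 * l)))
    \<le> 2 * cmod l / (1 - cmod l ^ 4) * cmod s"
proof -
  obtain U F A B where F: "local_extension f (neil_param l) U F"
    and D: "(F has_derivative (\<lambda>(u, w). A * u + B * w)) (at (neil_param l))"
    using neil_to_disk_local_extension[OF f neil_param_in_parabola[OF l]] .
  have "neil_differential f (neil_param l) (s * (3 * l\<^sup>2), s * (2 * l))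
      = s * (A * (3 * l\<^sup>2) + B * (2 * l))"
    using neil_differential_eq[OF tangent_along_parabola[OF l, of s] F D] by (simp add: algebra_simps)
  also have "A * (3 * l\<^sup>2) + B * (2 * l) = deriv (f \<circ> neil_param) l"
    using pullback_derivative[OF F l D] by (rule DERIV_imp_deriv[symmetric])
  finally have "poincare_metric (f (neil_param l)) (neil_differential f (neil_param l) (s * (3 * l\<^sup>2), s * (2 * l)))
      = poincare_metric ((f \<circ> neil_param) l) (deriv (f \<circ> neil_param) l) * cmod s"
    by (simp add: poincare_metric_def norm_mult)
  also have "\<dots> \<le> 2 * cmod l / (1 - cmod l ^ 4) * cmod s"
    using critical_at_zero_schwarz_pick[OF pullback_disk[OF f] l] by (intro mult_right_mono) auto
  finally show ?thesis .
qed

text \<open>With \<open>h\<close> the pullback of \<open>f\<close>, write \<open>h z = h 0 + z\<^sup>2 * q z\<close>, where \<open>q\<close> is obtained by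
  solving \<open>Moebius_function 0 (h 0) (h z) = z\<^sup>2 * g z\<close> for \<open>h z\<close>.  The partial derivatives at
  the cusp are the derivative of \<open>q\<close> at \<open>0\<close> and \<open>q 0\<close>.  As \<open>h\<close> is critical at \<open>0\<close>, these are \<open>deriv g 0\<close> and
  \<open>g 0\<close>, both scaled by \<open>1 - (cmod (h 0))\<^sup>2\<close>, which cancels against the denominator of the Poincare
  metric.  The Schwarz--Pick inequality at \<open>0\<close> then gives the estimate with \<open>t = cmod (g 0)\<close>.\<close>

lemma neil_metric_bound_cusp:
  assumes f: "f \<in> neil_to_disk"
  obtains t where "0 \<le> t" "t \<le> 1"
    "poincare_metric (f (0, 0)) (neil_differential f (0, 0) (v\<^sub>1, v\<^sub>2)) \<le> (1 - t\<^sup>2) * cmod v\<^sub>1 + t * cmod v\<^sub>2"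
proof -
  define h where "h = f \<circ> neil_param"
  note h = pullback_disk[OF f, folded h_def]
  obtain g where g: "g holomorphic_on ball 0 1" "\<And>z. cmod z < 1 \<Longrightarrow> cmod (g z) \<le> 1"
    and hg: "\<And>z. cmod z < 1 \<Longrightarrow> Moebius_function 0 (h 0) (h z) = z\<^sup>2 * g z"
    using critical_at_zero_factor[OF h] by metis
  have p0: "neil_param 0 = (0, 0)" by (simp add: neil_param_def)
  have h0: "h 0 = f (0, 0)" by (simp add: h_def p0)
  have h0b: "cmod (h 0) < 1" using h(2)[of 0] by simp
  define q where "q z = g z * (1 - cnj (h 0) * h z)" for z
  have hq: "h z = h 0 + z\<^sup>2 * q z" if "cmod z < 1" for z
    using hg[OF that] moebius_denominator_nonzero[OF h0b h(2)[OF that]]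
    by (simp add: q_def Moebius_function_simple field_simps)
  have cusp: "(0, 0) \<in> neil_parabola" by (simp add: neil_parabola_def)
  obtain U F A B where F: "local_extension f (0, 0) U F"
    and D: "(F has_derivative (\<lambda>(u, w). A * u + B * w)) (at (0, 0))"
    using neil_to_disk_local_extension[OF f cusp] .
  have FU: "nbhd_in_bidisk (0, 0) U" "holomorphic2_on F U" "(0, 0) \<in> U"
    "\<And>y. y \<in> U \<inter> neil_parabola \<Longrightarrow> F y = f y"
    using F by (auto simp: local_extension_def nbhd_in_bidisk_def)
  define m where "m = 1 - (cmod (h 0))\<^sup>2"
  have m: "m > 0" using h0b by (simp add: m_def abs_square_less_1)
  have mc: "1 - cnj (h 0) * h 0 = of_real m"
    using complex_norm_square[of "h 0"] by (simp add: m_def mult.commute)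
  have "(h has_field_derivative 0) (at 0)"
    using holomorphic_derivI[OF h(1), of 0] h(3) by simp
  moreover have "(g has_field_derivative deriv g 0) (at 0)"
    using holomorphic_derivI[OF g(1), of 0] by simp
  ultimately have q': "(q has_field_derivative deriv g 0 * of_real m) (at 0)"
    unfolding q_def[abs_def] mc[symmetric] by (auto intro!: derivative_eq_intros)
  have ev: "\<forall>\<^sub>F l in at 0. F (neil_param l) = F (0, 0) + l\<^sup>2 * q l"
  proof -
    have "\<forall>\<^sub>F l in nhds 0. neil_param l \<in> U \<inter> neil_parabola"
      using eventually_neil_param_in_nbhd[of 0 U] FU(1) by (simp add: p0)
    moreover have "\<forall>\<^sub>F l in nhds 0. l \<in> ball (0::complex) 1"
      by (intro eventually_nhds_in_open) auto
    ultimately have "\<forall>\<^sub>F l in nhds 0. F (neil_param l) = F (0, 0) + l\<^sup>2 * q l"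
    proof eventually_elim
      case (elim l)
      have "F (neil_param l) = h l" using FU(4)[OF elim(1)] by (simp add: h_def)
      moreover have "F (0, 0) = h 0" using FU(3,4) cusp h0 by simp
      ultimately show ?case using hq[of l] elim(2) by simp
    qed
    then show ?thesis by (simp add: eventually_at_filter eventually_mono)
  qed
  have AB: "A = deriv g 0 * of_real m" "B = g 0 * of_real m"
    using derivative_at_cusp_from_parabola[OF FU(2,3) D ev q'] by (simp_all add: q_def mc)
  have "neil_differential f (0, 0) (v\<^sub>1, v\<^sub>2) = of_real m * (deriv g 0 * v\<^sub>1 + g 0 * v\<^sub>2)"
    using neil_differential_eq[OF tangent_space_cusp F D, of "(v\<^sub>1, v\<^sub>2)"] by (simp add: AB algebra_simps)
  then have "poincare_metric (f (0, 0)) (neil_differential f (0, 0) (v\<^sub>1, v\<^sub>2))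
      = cmod (deriv g 0 * v\<^sub>1 + g 0 * v\<^sub>2)"
    using m by (simp add: poincare_metric_def norm_mult flip: h0 m_def)
  also have "\<dots> \<le> cmod (deriv g 0) * cmod v\<^sub>1 + cmod (g 0) * cmod v\<^sub>2"
    by (metis norm_mult norm_triangle_ineq)
  also have "\<dots> \<le> (1 - (cmod (g 0))\<^sup>2) * cmod v\<^sub>1 + cmod (g 0) * cmod v\<^sub>2"
    using schwarz_pick[OF g, of 0] by (intro add_right_mono mult_right_mono) auto
  finally show thesis using that[of "cmod (g 0)"] g(2)[of 0] by simp
qed

text \<open>The vertex of this concave quadratic in \<open>t\<close> lies at \<open>y / (2 * x)\<close>; the two cases are whether it is
  inside the unit interval.\<close>

lemma quadratic_max:
  fixes t x y :: real
  assumes "0 \<le> t" "t \<le> 1" "0 \<le> x" "0 \<le> y"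
  shows "(1 - t\<^sup>2) * x + t * y \<le> (if 2 * x \<le> y then y else (4 * x\<^sup>2 + y\<^sup>2) / (4 * x))"
proof (cases "2 * x \<le> y")
  case True
  have "(1 - t) * ((1 + t) * x) \<le> (1 - t) * y"
  proof (rule mult_left_mono)
    have "(1 + t) * x \<le> 2 * x" using assms by (intro mult_right_mono) auto
    then show "(1 + t) * x \<le> y" using True by linarith
  qed (use assms in simp)
  then show ?thesis using True by (simp add: algebra_simps power2_eq_square)
next
  case False
  then have x: "x > 0" using assms by simp
  have "0 \<le> (2 * x * t - y)\<^sup>2" by simp
  then have "((1 - t\<^sup>2) * x + t * y) * (4 * x) \<le> 4 * x\<^sup>2 + y\<^sup>2"
    by (simp add: algebra_simps power2_eq_square)
  then show ?thesis using False x by (simp add: pos_le_divide_eq)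
qed

section \<open>Extremal functions\<close>

text \<open>Functions of the form \<open>\<psi> w + z * \<phi> w\<close> extend to the whole bidisk.  On the parabola the first
  summand is the even part of the pullback and the second the odd part.\<close>

lemma even_odd_extension:
  fixes \<psi> \<phi> :: "complex \<Rightarrow> complex"
  assumes "\<psi> holomorphic_on ball 0 1" "\<phi> holomorphic_on ball 0 1"
    and bound: "\<And>l. cmod l < 1 \<Longrightarrow> cmod (\<psi> (l\<^sup>2) + l ^ 3 * \<phi> (l\<^sup>2)) < 1"
    and x: "(a, b) \<in> neil_parabola" and v: "(v\<^sub>1, v\<^sub>2) \<in> neil_tangent_space (a, b)"
  shows "(\<lambda>(z, w). \<psi> w + z * \<phi> w) \<in> neil_to_disk" (is "?F \<in> _")
    "neil_differential (\<lambda>(z, w). \<psi> w + z * \<phi> w) (a, b) (v\<^sub>1, v\<^sub>2)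
       = \<phi> b * v\<^sub>1 + (deriv \<psi> b + a * deriv \<phi> b) * v\<^sub>2"
proof -
  have D: "(?F has_derivative (\<lambda>(u, w). \<phi> d * u + (deriv \<psi> d + c * deriv \<phi> d) * w)) (at (c, d))"
    if "cmod d < 1" for c d
  proof -
    have "(\<psi> has_derivative (*) (deriv \<psi> d)) (at (snd (c, d)))"
      "(\<phi> has_derivative (*) (deriv \<phi> d)) (at (snd (c, d)))"
      using assms(1,2) that holomorphic_derivI[of _ "ball 0 1" d]
      by (auto simp flip: has_field_derivative_def)
    from this[THEN has_derivative_compose[OF has_derivative_snd[OF has_derivative_ident]]]
    have "((\<lambda>p. \<psi> (snd p) + fst p * \<phi> (snd p)) has_derivative
        (\<lambda>h. deriv \<psi> d * snd h + (fst (c, d) * (deriv \<phi> d * snd h) + fst h * \<phi> (snd (c, d))))) (at (c, d))"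
      by (intro has_derivative_add has_derivative_mult has_derivative_fst has_derivative_ident)
    then have "(?F has_derivative (\<lambda>h. deriv \<psi> d * snd h + (c * (deriv \<phi> d * snd h) + fst h * \<phi> d))) (at (c, d))"
      by (simp add: case_prod_unfold)
    then show ?thesis
      by (rule has_derivative_eq_rhs) (auto simp: algebra_simps)
  qed
  have "holomorphic2_on ?F (ball 0 1 \<times> ball 0 1)"
    unfolding holomorphic2_on_def using D by (fastforce intro!: open_Times)
  then have ext: "local_extension ?F y (ball 0 1 \<times> ball 0 1) ?F" if "y \<in> neil_parabola" for y
    using that by (auto simp: local_extension_def nbhd_in_bidisk_def neil_parabola_def intro!: open_Times)
  show "?F \<in> neil_to_disk"
    unfolding neil_to_disk_def holomorphic_on_neil_def
  proof (intro CollectI conjI ballI image_subsetI)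
    fix y assume y: "y \<in> neil_parabola"
    then show "\<exists>U F. local_extension ?F y U F" using ext by blast
    obtain l where "cmod l < 1" "y = (l ^ 3, l\<^sup>2)"
      using y neil_param_surj[of "fst y" "snd y"] by (metis prod.collapse)
    then show "?F y \<in> ball 0 1" using bound by simp
  qed
  have "cmod b < 1" using x by (simp add: neil_parabola_def)
  from neil_differential_eq[OF v ext[OF x] D[OF this]]
  show "neil_differential ?F (a, b) (v\<^sub>1, v\<^sub>2) = \<phi> b * v\<^sub>1 + (deriv \<psi> b + a * deriv \<phi> b) * v\<^sub>2"
    by simp
qed

text \<open>The second coordinate pulls back to \<open>l \<mapsto> l\<^sup>2\<close>, which is extremal at every point other than the
  cusp, and also at the cusp for directions with \<open>2 * cmod v\<^sub>1 \<le> cmod v\<^sub>2\<close>.\<close>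

lemma projection_in_neil_to_disk:
  assumes x: "(a, b) \<in> neil_parabola" and v: "(v\<^sub>1, v\<^sub>2) \<in> neil_tangent_space (a, b)"
  shows "snd \<in> neil_to_disk" "neil_differential snd (a, b) (v\<^sub>1, v\<^sub>2) = v\<^sub>2"
proof -
  have "cmod (l\<^sup>2 + l ^ 3 * 0) < 1" if "cmod l < 1" for l :: complex
    using that by (simp add: norm_power abs_square_less_1)
  note ext = even_odd_extension[of "\<lambda>w. w" "\<lambda>_. 0", OF holomorphic_on_ident holomorphic_on_const this x v]
  have eq: "(\<lambda>(z, w). w + z * 0) = (snd :: complex \<times> complex \<Rightarrow> complex)" by (simp add: fun_eq_iff)
  show "snd \<in> neil_to_disk" using ext(1) unfolding eq .
  show "neil_differential snd (a, b) (v\<^sub>1, v\<^sub>2) = v\<^sub>2" using ext(2) unfolding eq by simp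
qed

text \<open>The pullback is \<open>l\<^sup>2 * (c * l + t) / (1 + t * c * l)\<close>, that is \<open>l\<^sup>2 * g l\<close> with \<open>g\<close> a disk
  automorphism; such \<open>g\<close> turn the Schwarz--Pick inequality at \<open>0\<close> into an equality.  The functions
  \<open>\<psi>\<close> and \<open>\<phi>\<close> arise by expanding this fraction with \<open>1 - t * c * l\<close> and separating even from
  odd powers.\<close>

lemma moebius_extremal:
  fixes c :: complex and t :: real
  assumes c: "cmod c = 1" and t: "0 \<le> t" "t < 1"
  obtains f where "f \<in> neil_to_disk" "f (0, 0) = 0"
    "neil_differential f (0, 0) (v\<^sub>1, v\<^sub>2) = c * of_real (1 - t\<^sup>2) * v\<^sub>1 + of_real t * v\<^sub>2"
proof -
  define \<psi> where "\<psi> w = (of_real t * w - of_real t * c\<^sup>2 * w\<^sup>2) / (1 - (of_real t * c)\<^sup>2 * w)" for w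
  define \<phi> where "\<phi> w = c * of_real (1 - t\<^sup>2) / (1 - (of_real t * c)\<^sup>2 * w)" for w
  have nz: "1 - (of_real t * c)\<^sup>2 * w \<noteq> 0" if w: "cmod w < 1" for w
  proof
    assume "1 - (of_real t * c)\<^sup>2 * w = 0"
    then have "cmod ((of_real t * c)\<^sup>2 * w) = 1" by (metis norm_one right_minus_eq)
    then have "t\<^sup>2 * cmod w = 1" using c by (simp add: norm_mult norm_power)
    moreover have "t\<^sup>2 * cmod w \<le> 1 * cmod w" using t by (intro mult_right_mono) (auto simp: abs_square_le_1)
    ultimately show False using w by simp
  qed
  have hol: "\<psi> holomorphic_on ball 0 1" "\<phi> holomorphic_on ball 0 1"
    unfolding \<psi>_def[abs_def] \<phi>_def[abs_def] using nz by (auto intro!: holomorphic_intros)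
  have bound: "cmod (\<psi> (l\<^sup>2) + l ^ 3 * \<phi> (l\<^sup>2)) < 1" if l: "cmod l < 1" for l
  proof -
    have l2: "cmod (l\<^sup>2) < 1" using l by (simp add: norm_power abs_square_less_1)
    have cl: "cmod (c * l) < 1" using c l by (simp add: norm_mult)
    have mt: "cmod (- complex_of_real t) < 1" using t by simp
    have nz': "1 + of_real t * c * l \<noteq> 0"
      using moebius_denominator_nonzero[OF mt cl] by (simp add: mult.assoc)
    have "\<psi> (l\<^sup>2) + l ^ 3 * \<phi> (l\<^sup>2)
        = (of_real t * l\<^sup>2 - of_real t * c\<^sup>2 * l ^ 4 + l ^ 3 * c * (1 - (of_real t)\<^sup>2)) / (1 - (of_real t * c)\<^sup>2 * l\<^sup>2)"
      by (simp add: \<psi>_def \<phi>_def add_divide_distrib mult.assoc flip: power_mult)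
    also have "\<dots> = (l\<^sup>2 * (c * l + of_real t) * (1 - of_real t * c * l)) / ((1 + of_real t * c * l) * (1 - of_real t * c * l))"
      by (simp add: algebra_simps eval_nat_numeral)
    also have "\<dots> = l\<^sup>2 * Moebius_function 0 (- of_real t) (c * l)"
    proof -
      have "1 - (of_real t * c)\<^sup>2 * l\<^sup>2 = (1 + of_real t * c * l) * (1 - of_real t * c * l)"
        by (simp add: algebra_simps eval_nat_numeral)
      then have "1 - of_real t * c * l \<noteq> 0" using nz[OF l2] by force
      then show ?thesis using nz' by (simp add: Moebius_function_simple mult.assoc)
    qed
    finally have "cmod (\<psi> (l\<^sup>2) + l ^ 3 * \<phi> (l\<^sup>2)) = cmod (l\<^sup>2) * cmod (Moebius_function 0 (- of_real t) (c * l))"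
      by (simp add: norm_mult)
    also have "\<dots> \<le> cmod (l\<^sup>2) * 1"
      using Moebius_function_norm_lt_1[OF mt cl, of 0] by (intro mult_left_mono) auto
    finally show ?thesis using l2 by simp
  qed
  have "(\<psi> has_field_derivative of_real t) (at 0)"
    unfolding \<psi>_def[abs_def] by (auto intro!: derivative_eq_intros)
  then have d: "deriv \<psi> 0 = of_real t" by (rule DERIV_imp_deriv)
  have cusp: "(0, 0) \<in> neil_parabola" by (simp add: neil_parabola_def)
  note ext = even_odd_extension[OF hol bound cusp tangent_space_cusp[of "(v\<^sub>1, v\<^sub>2)"]]
  show thesis
  proof (rule that[OF ext(1)])
    have at0: "\<psi> 0 = 0" "\<phi> 0 = c * of_real (1 - t\<^sup>2)" by (simp_all add: \<psi>_def \<phi>_def)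
    show "(case (0, 0) of (z, w) \<Rightarrow> \<psi> w + z * \<phi> w) = 0" by (simp add: at0)
    show "neil_differential (\<lambda>(z, w). \<psi> w + z * \<phi> w) (0, 0) (v\<^sub>1, v\<^sub>2)
        = c * of_real (1 - t\<^sup>2) * v\<^sub>1 + of_real t * v\<^sub>2"
      using ext(2) by (simp add: at0 d)
  qed
qed

section \<open>The Caratheodory metric\<close>

theorem theorem2p4:
  shows "(\<forall>v\<^sub>1 v\<^sub>2 :: complex.
      (v\<^sub>1, v\<^sub>2) \<in> neil_tangent_space (0, 0) \<and>
      caratheodory_neil (0, 0) (v\<^sub>1, v\<^sub>2) =
        ereal (if cmod v\<^sub>2 \<ge> 2 * cmod v\<^sub>1 then cmod v\<^sub>2
               else (4 * (cmod v\<^sub>1)\<^sup>2 + (cmod v\<^sub>2)\<^sup>2) / (4 * cmod v\<^sub>1))) \<and>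
    (\<forall>a b z :: complex. (a, b) \<in> neil_parabola \<longrightarrow> (a, b) \<noteq> (0, 0) \<longrightarrow>
      (z * (3 * a), z * (2 * b)) \<in> neil_tangent_space (a, b) \<and>
      caratheodory_neil (a, b) (z * (3 * a), z * (2 * b)) =
        ereal (2 * cmod b / (1 - (cmod b)\<^sup>2) * cmod z))"
proof (intro conjI allI impI)
  fix v\<^sub>1 v\<^sub>2 :: complex
  show "(v\<^sub>1, v\<^sub>2) \<in> neil_tangent_space (0, 0)" by (rule tangent_space_cusp)
  have cusp: "(0, 0) \<in> neil_parabola" by (simp add: neil_parabola_def)
  define x y where "x = cmod v\<^sub>1" and "y = cmod v\<^sub>2"
  let ?C = "if 2 * x \<le> y then y else (4 * x\<^sup>2 + y\<^sup>2) / (4 * x)"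
  have "caratheodory_neil (0, 0) (v\<^sub>1, v\<^sub>2) = ereal ?C"
    unfolding caratheodory_neil_def
  proof (rule antisym)
    show "(SUP f\<in>neil_to_disk. ereal (poincare_metric (f (0, 0)) (neil_differential f (0, 0) (v\<^sub>1, v\<^sub>2)))) \<le> ereal ?C"
    proof (rule SUP_least)
      fix f assume "f \<in> neil_to_disk"
      then obtain t where t: "0 \<le> t" "t \<le> 1"
        and le: "poincare_metric (f (0, 0)) (neil_differential f (0, 0) (v\<^sub>1, v\<^sub>2)) \<le> (1 - t\<^sup>2) * x + t * y"
        unfolding x_def y_def by (rule neil_metric_bound_cusp)
      note le
      also have "(1 - t\<^sup>2) * x + t * y \<le> ?C"
        by (rule quadratic_max) (use t in \<open>auto simp: x_def y_def\<close>)
      finally show "ereal (poincare_metric (f (0, 0)) (neil_differential f (0, 0) (v\<^sub>1, v\<^sub>2))) \<le> ereal ?C"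
        by simp
    qed
    have "\<exists>f\<in>neil_to_disk. poincare_metric (f (0, 0)) (neil_differential f (0, 0) (v\<^sub>1, v\<^sub>2)) = ?C"
    proof (cases "2 * x \<le> y")
      case True
      then show ?thesis
        using projection_in_neil_to_disk[OF cusp tangent_space_cusp]
        by (intro bexI[of _ snd]) (auto simp: poincare_metric_def y_def)
    next
      case False
      then have x: "x > 0" using norm_ge_zero[of v\<^sub>2] unfolding y_def by linarith
      \<comment> \<open>The maximiser of the quadratic in \<open>quadratic_max\<close>.\<close>
      define t where "t = y / (2 * x)"
      have t: "0 \<le> t" "t < 1" using False x by (auto simp: t_def y_def)
      \<comment> \<open>Phases: with \<open>c = u / s\<close> the two summands of the differential have the same argument, so
            their moduli add up.\<close>
      define u where "u = (if v\<^sub>2 = 0 then 1 else sgn v\<^sub>2)"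
      have polar: "w = sgn w * of_real (cmod w)" for w :: complex
        by (cases "w = 0") (simp_all add: sgn_div_norm scaleR_conv_of_real)
      have u: "cmod u = 1" "v\<^sub>2 = u * of_real y"
        using polar[of v\<^sub>2] by (auto simp: u_def norm_sgn y_def)
      define s where "s = sgn v\<^sub>1"
      have s: "s \<noteq> 0" "cmod s = 1" "v\<^sub>1 = s * of_real x"
        using x polar[of v\<^sub>1] by (auto simp: s_def norm_sgn x_def sgn_zero_iff)
      have "cmod (u / s) = 1" using u s by (simp add: norm_divide)
      from moebius_extremal[OF this t, of v\<^sub>1 v\<^sub>2]
      obtain f where f: "f \<in> neil_to_disk" "f (0, 0) = 0"
        "neil_differential f (0, 0) (v\<^sub>1, v\<^sub>2) = u / s * of_real (1 - t\<^sup>2) * v\<^sub>1 + of_real t * v\<^sub>2" .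
      have "u / s * of_real (1 - t\<^sup>2) * v\<^sub>1 + of_real t * v\<^sub>2
          = u / s * of_real (1 - t\<^sup>2) * (s * of_real x) + of_real t * (u * of_real y)"
        using s(3) u(2) by simp
      also have "\<dots> = u * of_real ((1 - t\<^sup>2) * x + t * y)"
        using s(1) by (simp add: algebra_simps)
      finally have "neil_differential f (0, 0) (v\<^sub>1, v\<^sub>2) = u * of_real ((1 - t\<^sup>2) * x + t * y)"
        using f(3) by (rule trans[rotated])
      then have "cmod (neil_differential f (0, 0) (v\<^sub>1, v\<^sub>2)) = \<bar>(1 - t\<^sup>2) * x + t * y\<bar>"
        using u(1) by (simp only: norm_mult norm_of_real mult_1)
      also have "\<dots> = (1 - t\<^sup>2) * x + t * y"
        using t x by (intro abs_of_nonneg add_nonneg_nonneg mult_nonneg_nonneg)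
          (auto simp: abs_square_le_1 y_def)
      also have "\<dots> = (4 * x\<^sup>2 + y\<^sup>2) / (4 * x)"
        using x by (simp add: t_def field_simps power2_eq_square)
      finally show ?thesis using f(1,2) False by (intro bexI[of _ f]) (auto simp: poincare_metric_def)
    qed
    then obtain f where "f \<in> neil_to_disk"
      "poincare_metric (f (0, 0)) (neil_differential f (0, 0) (v\<^sub>1, v\<^sub>2)) = ?C" by blast
    then show "ereal ?C \<le> (SUP f\<in>neil_to_disk. ereal (poincare_metric (f (0, 0)) (neil_differential f (0, 0) (v\<^sub>1, v\<^sub>2))))"
      by (intro SUP_upper2[of f]) simp_all
  qed
  then show "caratheodory_neil (0, 0) (v\<^sub>1, v\<^sub>2) =
      ereal (if 2 * cmod v\<^sub>1 \<le> cmod v\<^sub>2 then cmod v\<^sub>2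
             else (4 * (cmod v\<^sub>1)\<^sup>2 + (cmod v\<^sub>2)\<^sup>2) / (4 * cmod v\<^sub>1))"
    by (simp only: x_def y_def)
next
  fix a b z :: complex
  assume ab: "(a, b) \<in> neil_parabola"
  obtain l where l: "cmod l < 1" "a = l ^ 3" "b = l\<^sup>2" using neil_param_surj[OF ab] .
  have p: "neil_param l = (a, b)" by (simp add: neil_param_def l)
  \<comment> \<open>The tangent vector is \<open>z * l\<close> times the velocity of the parametrisation at \<open>l\<close>.\<close>
  have v: "(z * (3 * a), z * (2 * b)) = ((z * l) * (3 * l\<^sup>2), (z * l) * (2 * l))"
    by (simp add: l eval_nat_numeral)
  show tangent: "(z * (3 * a), z * (2 * b)) \<in> neil_tangent_space (a, b)"
    using tangent_along_parabola[OF l(1), of "z * l"] unfolding v p .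
  have cb: "cmod b = (cmod l)\<^sup>2" by (simp add: l norm_power)
  then have cb2: "(cmod b)\<^sup>2 = cmod l ^ 4" by (simp flip: power_mult)
  let ?C = "2 * cmod b / (1 - (cmod b)\<^sup>2) * cmod z"
  show "caratheodory_neil (a, b) (z * (3 * a), z * (2 * b)) = ereal ?C"
    unfolding caratheodory_neil_def
  proof (rule antisym)
    have "2 * cmod l / (1 - cmod l ^ 4) * cmod (z * l) = ?C"
      unfolding cb2 by (simp add: cb norm_mult power2_eq_square)
    then show "(SUP f\<in>neil_to_disk. ereal (poincare_metric (f (a, b))
        (neil_differential f (a, b) (z * (3 * a), z * (2 * b))))) \<le> ereal ?C"
      using neil_metric_bound_along_curve[OF _ l(1), of _ "z * l", unfolded p, folded v]
      by (intro SUP_least) simp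
    have "poincare_metric (snd (a, b)) (neil_differential snd (a, b) (z * (3 * a), z * (2 * b))) = ?C"
      unfolding projection_in_neil_to_disk(2)[OF ab tangent]
      by (simp add: poincare_metric_def norm_mult)
    then show "ereal ?C \<le> (SUP f\<in>neil_to_disk. ereal (poincare_metric (f (a, b))
        (neil_differential f (a, b) (z * (3 * a), z * (2 * b)))))"
      using projection_in_neil_to_disk(1)[OF ab tangent] by (intro SUP_upper2[of snd]) simp_all
  qed
qed

end
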